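(* For every $k\ge 1$ and $n\ge k+2$ we have $\mathrm{av}_n^k(1324,2143)=2p(k)$, where $p(k)$ is the number of integer partitions of $k$.
   Context: $\mathrm{av}_n^k(B)$ is the number of permutations in $S_n$ with exactly $k$ inversions (pairs $i<j$ with $\pi_i>\pi_j$) that avoid every pattern in $B$; a permutation avoids a pattern $q$ if it has no subsequence order-isomorphic to $q$. *)

theory Defs
  imports "HOL-Combinatorics.Multiset_Permutations" "HOL-Library.Sublist" "HOL-Library.Multiset"
begin

text \<open>
  Permutations in \<open>S_n\<close> are represented in one-line notation, i.e. as the elements of
  \<^term>\<open>permutations_of_set {1..n::nat}\<close>: the duplicate-free lists with entry set \<open>{1..n}\<close>.
  List positions are counted from 0, which affects neither inversions nor pattern containment.
\<close>

definition inversions :: "nat list \<Rightarrow> (nat \<times> nat) set" where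
  "inversions xs = {(i, j). i < j \<and> j < length xs \<and> xs ! i > xs ! j}"

definition order_isomorphic :: "nat list \<Rightarrow> nat list \<Rightarrow> bool" where
  "order_isomorphic xs ys \<longleftrightarrow> length xs = length ys \<and>
     (\<forall>i < length xs. \<forall>j < length xs. xs ! i < xs ! j \<longleftrightarrow> ys ! i < ys ! j)"

text \<open>The library relation \<^const>\<open>subseq\<close> allows non-contiguous subsequences.\<close>

definition avoids :: "nat list \<Rightarrow> nat list \<Rightarrow> bool" where
  "avoids xs q \<longleftrightarrow> \<not> (\<exists>ys. subseq ys xs \<and> order_isomorphic ys q)"

definition av :: "nat \<Rightarrow> nat \<Rightarrow> nat list set \<Rightarrow> nat" where
  "av n k B = card {xs \<in> permutations_of_set {1..n}.
     card (inversions xs) = k \<and> (\<forall>q \<in> B. avoids xs q)}"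

text \<open>An integer partition of \<open>k\<close> is a multiset of positive integers with sum \<open>k\<close>.\<close>

definition integer_partitions :: "nat \<Rightarrow> nat multiset set" where
  "integer_partitions k = {M. (\<forall>x \<in># M. x > 0) \<and> sum_mset M = k}"

definition num_partitions :: "nat \<Rightarrow> nat" where
  "num_partitions k = card (integer_partitions k)"

text \<open>
  Since \<^const>\<open>card\<close> is 0 on infinite sets, we record that the sets counted above are finite.
\<close>

lemma finite_inversions: "finite (inversions xs)"
  by (rule finite_subset[of _ "{..<length xs} \<times> {..<length xs}"])
     (auto simp: inversions_def)

lemma finite_av_set:
  "finite {xs \<in> permutations_of_set {1..n::nat}.
     card (inversions xs) = k \<and> (\<forall>q \<in> B. avoids xs q)}"
  by simp

lemma finite_integer_partitions: "finite (integer_partitions k)"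
proof (rule finite_subset)
  have size_le: "size M \<le> sum_mset M" if "\<forall>x \<in># M. x > 0" for M :: "nat multiset"
    using that by (induction M) auto
  have elem_le: "x \<le> sum_mset M" if "x \<in># M" for x and M :: "nat multiset"
    using that by (metis le_add1 multi_member_split sum_mset.add_mset)
  show "integer_partitions k \<subseteq> mset ` {xs. set xs \<subseteq> {..k} \<and> length xs \<le> k}"
  proof
    fix M assume "M \<in> integer_partitions k"
    hence M: "\<forall>x \<in># M. x > 0" "sum_mset M = k"
      by (auto simp: integer_partitions_def)
    obtain xs where xs: "mset xs = M"
      using ex_mset by blast
    have "set xs \<subseteq> {..k}" "length xs \<le> k"
      using size_le[OF M(1)] elem_le[of _ M] M(2) xs by (auto simp flip: set_mset_mset size_mset)
    thus "M \<in> mset ` {xs. set xs \<subseteq> {..k} \<and> length xs \<le> k}"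
      using xs by blast
  qed
  show "finite (mset ` {xs. set xs \<subseteq> {..k} \<and> length xs \<le> k})"
    by (intro finite_imageI finite_lists_length_le) simp
qed

end

theory Submission
  imports Defs
begin

text \<open>
  A permutation of length \<open>n \<ge> k + 2\<close> with \<open>k\<close> inversions splits as a direct sum \<open>us \<oplus> vs\<close>
  of two nonempty blocks. Every inversion lies inside one block. If it is part of a 132 inside
  \<open>us\<close>, any entry of \<open>vs\<close> extends it to a 1324; symmetrically for a 213 inside \<open>vs\<close>. So a
  permutation avoiding 1324 and 2143 cannot contain both 132 and 213: the inversions of the two
  occurrences would lie in \<open>vs\<close> and \<open>us\<close> and form a 2143. Conversely 1324 and 2143 each contain
  132 and 213, and as \<open>k \<ge> 1\<close> no such sum avoids both of these. Hence the count is the number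
  of 132-avoiders plus the number of 213-avoiders, and these are equal by reverse complement.
  A permutation avoids 132 iff its Lehmer code is weakly decreasing, i.e. a partition of \<open>k\<close> padded
  by zeros; for \<open>n > k\<close> every partition of \<open>k\<close> satisfies the bounds required of a code.
\<close>

section \<open>Patterns as inequalities between the entries of a subsequence\<close>

lemma order_isomorphic_length_3:
  "order_isomorphic ys [p, q, r] \<longleftrightarrow>
     (\<exists>a b c. ys = [a, b, c] \<and> order_isomorphic [a, b, c] [p, q, r])"
proof
  assume *: "order_isomorphic ys [p, q, r]"
  then have "length ys = Suc (Suc (Suc 0))" by (simp add: order_isomorphic_def)
  then obtain a b c where "ys = [a, b, c]" by (auto simp: length_Suc_conv)
  with * show "\<exists>a b c. ys = [a, b, c] \<and> order_isomorphic [a, b, c] [p, q, r]" by blast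
qed blast

lemma order_isomorphic_length_4:
  "order_isomorphic ys [p, q, r, s] \<longleftrightarrow>
     (\<exists>a b c d. ys = [a, b, c, d] \<and> order_isomorphic [a, b, c, d] [p, q, r, s])"
proof
  assume *: "order_isomorphic ys [p, q, r, s]"
  then have "length ys = Suc (Suc (Suc (Suc 0)))" by (simp add: order_isomorphic_def)
  then obtain a b c d where "ys = [a, b, c, d]" by (auto simp: length_Suc_conv)
  with * show "\<exists>a b c d. ys = [a, b, c, d] \<and> order_isomorphic [a, b, c, d] [p, q, r, s]"
    by blast
qed blast

text \<open>By transitivity, the chain of two inequalities settles all the comparisons between three
  entries that \<open>order_isomorphic\<close> asks for. The later characterisations of this kind
  work in the same way.\<close>

lemma avoids_132_iff:
  "avoids xs [1,3,2] \<longleftrightarrow> \<not> (\<exists>a b c. subseq [a, b, c] xs \<and> a < c \<and> c < b)"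
proof -
  have *: "order_isomorphic [a, b, c] [1,3,2] \<longleftrightarrow> a < c \<and> c < b" for a b c
  proof
    assume "a < c \<and> c < b"
    then show "order_isomorphic [a, b, c] [1,3,2]"
      by (simp add: order_isomorphic_def All_less_Suc less_not_sym)
  qed (simp add: order_isomorphic_def All_less_Suc)
  have "order_isomorphic ys [1,3,2] \<longleftrightarrow> (\<exists>a b c. ys = [a, b, c] \<and> a < c \<and> c < b)" for ys
    by (subst order_isomorphic_length_3) (simp only: *)
  then show ?thesis
    by (simp only: avoids_def) blast
qed

lemma avoids_213_iff:
  "avoids xs [2,1,3] \<longleftrightarrow> \<not> (\<exists>a b c. subseq [a, b, c] xs \<and> b < a \<and> a < c)"
proof -
  have *: "order_isomorphic [a, b, c] [2,1,3] \<longleftrightarrow> b < a \<and> a < c" for a b c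
  proof
    assume "b < a \<and> a < c"
    then show "order_isomorphic [a, b, c] [2,1,3]"
      by (simp add: order_isomorphic_def All_less_Suc less_not_sym)
  qed (simp add: order_isomorphic_def All_less_Suc)
  have "order_isomorphic ys [2,1,3] \<longleftrightarrow> (\<exists>a b c. ys = [a, b, c] \<and> b < a \<and> a < c)" for ys
    by (subst order_isomorphic_length_3) (simp only: *)
  then show ?thesis
    by (simp only: avoids_def) blast
qed

lemma avoids_1324_iff:
  "avoids xs [1,3,2,4] \<longleftrightarrow> \<not> (\<exists>a b c d. subseq [a, b, c, d] xs \<and> a < c \<and> c < b \<and> b < d)"
proof -
  have *: "order_isomorphic [a, b, c, d] [1,3,2,4] \<longleftrightarrow> a < c \<and> c < b \<and> b < d" for a b c d
  proof
    assume "a < c \<and> c < b \<and> b < d"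
    then show "order_isomorphic [a, b, c, d] [1,3,2,4]"
      by (simp add: order_isomorphic_def All_less_Suc less_not_sym)
  qed (simp add: order_isomorphic_def All_less_Suc)
  have "order_isomorphic ys [1,3,2,4] \<longleftrightarrow> (\<exists>a b c d. ys = [a, b, c, d] \<and> a < c \<and> c < b \<and> b < d)" for ys
    by (subst order_isomorphic_length_4) (simp only: *)
  then show ?thesis
    by (simp only: avoids_def) blast
qed

lemma avoids_2143_iff:
  "avoids xs [2,1,4,3] \<longleftrightarrow> \<not> (\<exists>a b c d. subseq [a, b, c, d] xs \<and> b < a \<and> a < d \<and> d < c)"
proof -
  have *: "order_isomorphic [a, b, c, d] [2,1,4,3] \<longleftrightarrow> b < a \<and> a < d \<and> d < c" for a b c d
  proof
    assume "b < a \<and> a < d \<and> d < c"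
    then show "order_isomorphic [a, b, c, d] [2,1,4,3]"
      by (simp add: order_isomorphic_def All_less_Suc less_not_sym)
  qed (simp add: order_isomorphic_def All_less_Suc)
  have "order_isomorphic ys [2,1,4,3] \<longleftrightarrow> (\<exists>a b c d. ys = [a, b, c, d] \<and> b < a \<and> a < d \<and> d < c)" for ys
    by (subst order_isomorphic_length_4) (simp only: *)
  then show ?thesis
    by (simp only: avoids_def) blast
qed

lemma subseq_4_D:
  assumes "subseq [a, b, c, d] xs"
  shows "subseq [a, b, c] xs" "subseq [b, c, d] xs"
  by (rule subseq_order.trans[OF _ assms], simp)+

lemma avoids_132_D:
  "avoids xs [1,3,2] \<Longrightarrow> subseq [a, b, c] xs \<Longrightarrow> a < c \<Longrightarrow> c < b \<Longrightarrow> False"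
  unfolding avoids_132_iff by iprover

lemma avoids_213_D:
  "avoids xs [2,1,3] \<Longrightarrow> subseq [a, b, c] xs \<Longrightarrow> b < a \<Longrightarrow> a < c \<Longrightarrow> False"
  unfolding avoids_213_iff by iprover

lemma avoids_1324_D:
  "avoids xs [1,3,2,4] \<Longrightarrow> subseq [a, b, c, d] xs \<Longrightarrow> a < c \<Longrightarrow> c < b \<Longrightarrow> b < d \<Longrightarrow> False"
  unfolding avoids_1324_iff by iprover

lemma avoids_2143_D:
  "avoids xs [2,1,4,3] \<Longrightarrow> subseq [a, b, c, d] xs \<Longrightarrow> b < a \<Longrightarrow> a < d \<Longrightarrow> d < c \<Longrightarrow> False"
  unfolding avoids_2143_iff by iprover

text \<open>The first three letters of 1324 and the last three letters of 2143 form a 132.\<close>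

lemma avoids_132_imp:
  assumes "avoids xs [1,3,2]"
  shows "avoids xs [1,3,2,4]" "avoids xs [2,1,4,3]"
proof -
  show "avoids xs [1,3,2,4]"
    unfolding avoids_1324_iff
  proof (intro notI, elim exE conjE)
    fix a b c d assume abcd: "subseq [a, b, c, d] xs" "a < c" "c < b" "b < d"
    show False
      by (rule avoids_132_D[OF assms subseq_4_D(1)[OF abcd(1)] abcd(2,3)])
  qed
  show "avoids xs [2,1,4,3]"
    unfolding avoids_2143_iff
  proof (intro notI, elim exE conjE)
    fix a b c d assume abcd: "subseq [a, b, c, d] xs" "b < a" "a < d" "d < c"
    show False
      by (rule avoids_132_D[OF assms subseq_4_D(2)[OF abcd(1)] less_trans[OF abcd(2,3)] abcd(4)])
  qed
qed

text \<open>The last three letters of 1324 and the first three letters of 2143 form a 213.\<close>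

lemma avoids_213_imp:
  assumes "avoids xs [2,1,3]"
  shows "avoids xs [1,3,2,4]" "avoids xs [2,1,4,3]"
proof -
  show "avoids xs [1,3,2,4]"
    unfolding avoids_1324_iff
  proof (intro notI, elim exE conjE)
    fix a b c d assume abcd: "subseq [a, b, c, d] xs" "a < c" "c < b" "b < d"
    show False
      by (rule avoids_213_D[OF assms subseq_4_D(2)[OF abcd(1)] abcd(3,4)])
  qed
  show "avoids xs [2,1,4,3]"
    unfolding avoids_2143_iff
  proof (intro notI, elim exE conjE)
    fix a b c d assume abcd: "subseq [a, b, c, d] xs" "b < a" "a < d" "d < c"
    show False
      by (rule avoids_213_D[OF assms subseq_4_D(1)[OF abcd(1)] abcd(2) less_trans[OF abcd(3,4)]])
  qed
qed

section \<open>The Lehmer code\<close>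

fun lehmer :: "nat list \<Rightarrow> nat list" where
  "lehmer [] = []"
| "lehmer (x # xs) = length (filter (\<lambda>y. y < x) xs) # lehmer xs"

lemma length_lehmer [simp]: "length (lehmer xs) = length xs"
  by (induction xs) auto

lemma lehmer_nth:
  "i < length xs \<Longrightarrow> lehmer xs ! i = length (filter (\<lambda>y. y < xs ! i) (drop (Suc i) xs))"
  by (induction xs arbitrary: i) (auto simp: nth_Cons split: nat.splits)

lemma inversions_Cons:
  "inversions (x # xs) =
     (\<lambda>j. (0, Suc j)) ` {j. j < length xs \<and> xs ! j < x} \<union> map_prod Suc Suc ` inversions xs"
  (is "_ = ?R")
proof (rule set_eqI)
  fix p :: "nat \<times> nat"
  obtain i j where p: "p = (i, j)" by fastforce
  show "p \<in> inversions (x # xs) \<longleftrightarrow> p \<in> ?R"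
    unfolding p by (cases i; cases j) (auto simp: inversions_def)
qed

text \<open>Each entry of the code counts the inversions with a given left position.\<close>

lemma card_inversions: "card (inversions xs) = sum_list (lehmer xs)"
proof (induction xs)
  case Nil
  then show ?case by (simp add: inversions_def)
next
  case (Cons x xs)
  have "card (inversions (x # xs)) =
      card ((\<lambda>j. (0::nat, Suc j)) ` {j. j < length xs \<and> xs ! j < x}) +
      card (map_prod Suc Suc ` inversions xs)"
    unfolding inversions_Cons by (intro card_Un_disjoint) (auto simp: finite_inversions)
  also have "\<dots> = length (filter (\<lambda>y. y < x) xs) + card (inversions xs)"
    by (subst (1 2) card_image)
      (auto simp: inj_on_def length_filter_conv_card)
  finally show ?case using Cons by simp
qed

text \<open>The head of the code is the rank of the head of the list in the entry set, so it
  determines that head. Removing it leaves equal entry sets and equal codes for the tails.\<close>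

lemma lehmer_inj:
  assumes "distinct xs" "distinct ys" "set xs = set ys" "lehmer xs = lehmer ys"
  shows "xs = ys"
  using assms
proof (induction xs arbitrary: ys)
  case Nil
  then show ?case by simp
next
  case (Cons x xs ys')
  then obtain y ys where ys': "ys' = y # ys"
    by (cases ys') auto
  \<comment> \<open>The count is moved from the tail to the whole entry set, which both lists share;
    \<open>z\<close> is not below itself.\<close>
  have count: "length (filter (\<lambda>u. u < z) zs) = card {u \<in> set (z # zs). u < z}"
    if "distinct (z # zs)" for z :: nat and zs
    using that by (subst distinct_card [symmetric]) (auto intro!: arg_cong [where f = card])
  have same: "card {u \<in> set (x # xs). u < x} = card {u \<in> set (x # xs). u < y}"
    using Cons.prems count[of x xs] count[of y ys] by (simp add: ys' del: list.set)
  have "\<not> x < y"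
  proof
    assume "x < y"
    then have "{u \<in> set (x # xs). u < x} \<subset> {u \<in> set (x # xs). u < y}" by auto
    from psubset_card_mono[OF _ this] same show False by simp
  qed
  moreover have "\<not> y < x"
  proof
    assume "y < x"
    moreover have "y \<in> set (x # xs)" using Cons.prems(3) ys' by simp
    ultimately have "{u \<in> set (x # xs). u < y} \<subset> {u \<in> set (x # xs). u < x}" by auto
    from psubset_card_mono[OF _ this] same show False by simp
  qed
  ultimately have "x = y" by simp
  moreover have "xs = ys"
  proof (rule Cons.IH)
    show "set xs = set ys"
      using Cons.prems \<open>x = y\<close> ys' by (metis Diff_insert_absorb distinct.simps(2) list.set(2))
  qed (use Cons.prems ys' in auto)
  ultimately show ?case using ys' by simp
qed

text \<open>Decoding is greedy: the head is the element of rank \<open>c\<close> in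
  \<open>A\<close>, and the remaining code is decoded over the rest of \<open>A\<close>. The bound
  says that each rank still exists after \<open>i\<close> elements have been used.\<close>

lemma lehmer_surj:
  assumes "finite A" "length cs = card A" "\<And>i. i < card A \<Longrightarrow> cs ! i + i < card A"
  shows "\<exists>xs \<in> permutations_of_set A. lehmer xs = cs"
  using assms
proof (induction cs arbitrary: A)
  case Nil
  then show ?case by (auto simp: permutations_of_set_def)
next
  case (Cons c cs)
  define s where "s = sorted_list_of_set A"
  have s: "sorted_wrt (<) s" "set s = A" "length s = card A" "distinct s"
    using Cons.prems by (auto simp: s_def)
  have c: "c < length s"
    using Cons.prems(2) Cons.prems(3)[of 0] s by auto
  \<comment> \<open>Ranks start at 0, so exactly \<open>c\<close> elements of \<open>A\<close> are
    smaller than \<open>x\<close>.\<close>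
  define x where "x = s ! c"
  have x: "x \<in> A" using c s by (auto simp: x_def)
  have less: "s ! i < x \<longleftrightarrow> i < c" if "i < length s" for i
    using s(1) c that unfolding x_def
    by (metis not_less_iff_gr_or_eq sorted_wrt_iff_nth_less)
  have cardA: "card (A - {x}) = length cs"
    using Cons.prems x by simp
  have "\<exists>xs \<in> permutations_of_set (A - {x}). lehmer xs = cs"
  proof (rule Cons.IH)
    fix i assume "i < card (A - {x})"
    then show "cs ! i + i < card (A - {x})"
      using Cons.prems(2) Cons.prems(3)[of "Suc i"] cardA by simp
  qed (use Cons.prems cardA in auto)
  then obtain xs where xs: "set xs = A - {x}" "distinct xs" "lehmer xs = cs"
    by (auto simp: permutations_of_set_def)
  have "length (filter (\<lambda>y. y < x) xs) = card {y \<in> A. y < x}"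
    using xs by (subst distinct_card [symmetric]) (auto intro!: arg_cong [where f = card])
  also have "\<dots> = length (filter (\<lambda>y. y < x) s)"
    using s by (subst distinct_card [symmetric]) (auto intro!: arg_cong [where f = card])
  also have "\<dots> = card {i. i < length s \<and> s ! i < x}"
    by (rule length_filter_conv_card)
  also have "{i. i < length s \<and> s ! i < x} = {..<c}"
    using less c by auto
  finally have "lehmer (x # xs) = c # cs" using xs by simp
  moreover have "x # xs \<in> permutations_of_set A"
    using xs x by (auto simp: permutations_of_set_def)
  ultimately show ?case by blast
qed

section \<open>Codes of permutations avoiding 132\<close>

lemma length_filter_mono:
  "(\<And>x. x \<in> set xs \<Longrightarrow> P x \<Longrightarrow> Q x) \<Longrightarrow> length (filter P xs) \<le> length (filter Q xs)"
  by (induction xs) auto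

lemma length_filter_strict_mono:
  assumes "\<And>x. x \<in> set xs \<Longrightarrow> P x \<Longrightarrow> Q x" "z \<in> set xs" "Q z" "\<not> P z"
  shows "length (filter P xs) < length (filter Q xs)"
  using assms
proof (induction xs)
  case (Cons x xs)
  then show ?case
    using length_filter_mono[of xs P Q] by (cases "z \<in> set xs") (auto simp: less_Suc_eq_le)
qed simp

lemma subseq_set: "subseq xs ys \<Longrightarrow> set xs \<subseteq> set ys"
  by (induction rule: list_emb.induct) auto

text \<open>Induction on the list: once the tail avoids 132, whether the new head starts a 132
  depends only on how its code entry compares with the next one.\<close>

lemma avoids_132_iff_lehmer:
  assumes "distinct xs"
  shows "avoids xs [1,3,2] \<longleftrightarrow> sorted_wrt (\<ge>) (lehmer xs)"
  using assms
proof (induction xs)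
  case Nil
  show ?case unfolding avoids_132_iff by simp
next
  case (Cons x ys)
  have IH: "avoids ys [1,3,2] \<longleftrightarrow> sorted_wrt (\<ge>) (lehmer ys)"
    using Cons by simp
  \<comment> \<open>An occurrence not contained in the tail uses \<open>x\<close> as its first and
    smallest letter.\<close>
  have split: "avoids (x # ys) [1,3,2] \<longleftrightarrow>
      avoids ys [1,3,2] \<and> \<not> (\<exists>b c. subseq [b, c] ys \<and> x < c \<and> c < b)"
  proof (intro iffI conjI notI)
    assume av: "avoids (x # ys) [1,3,2]"
    show "avoids ys [1,3,2]"
      unfolding avoids_132_iff
    proof (intro notI, elim exE conjE)
      fix a b c assume "subseq [a, b, c] ys" "a < c" "c < b"
      then show False
        by (intro avoids_132_D[OF av list_emb_Cons])
    qed
    assume "\<exists>b c. subseq [b, c] ys \<and> x < c \<and> c < b"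
    then obtain b c where "subseq [b, c] ys" "x < c" "c < b" by (elim exE conjE)
    then show False
      by (intro avoids_132_D[OF av, of x b c]) auto
  next
    assume *: "avoids ys [1,3,2] \<and> \<not> (\<exists>b c. subseq [b, c] ys \<and> x < c \<and> c < b)"
    show "avoids (x # ys) [1,3,2]"
      unfolding avoids_132_iff
    proof (intro notI, elim exE conjE)
      fix a b c assume abc: "subseq [a, b, c] (x # ys)" "a < c" "c < b"
      then consider "subseq [a, b, c] ys" | "a = x" "subseq [b, c] ys"
        by (auto simp: subseq_Cons2_iff split: if_splits)
      then show False
      proof cases
        case 1
        from avoids_132_D[OF conjunct1[OF *] 1 abc(2,3)] show ?thesis .
      next
        case 2
        then have "\<exists>b c. subseq [b, c] ys \<and> x < c \<and> c < b"
          using abc(2,3) by (intro exI[of _ b] exI[of _ c]) simp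
        with * show ?thesis by simp
      qed
    qed
  qed
  show ?case
  proof (cases ys)
    case Nil
    then show ?thesis unfolding avoids_132_iff by simp
  next
    case ys: (Cons y zs)
    have ne: "x \<noteq> y" using Cons.prems ys by auto
    have sorted: "sorted_wrt (\<ge>) (lehmer (x # ys)) \<longleftrightarrow>
        sorted_wrt (\<ge>) (lehmer ys) \<and>
        length (filter (\<lambda>u. u < y) zs) \<le> length (filter (\<lambda>u. u < x) ys)"
      by (auto simp: ys)
    \<comment> \<open>Given such \<open>b\<close> and \<open>c\<close>, also \<open>c < y\<close>,
      since otherwise \<open>y\<close>, \<open>b\<close>, \<open>c\<close> would be a 132 in the
      tail; hence \<open>c\<close> is counted for \<open>y\<close> but not for \<open>x\<close>, and
      everything counted for \<open>x\<close> is counted for \<open>y\<close>. Conversely, any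
      \<open>c\<close> counted for \<open>y\<close> but not for \<open>x\<close> gives the
      occurrence \<open>x\<close>, \<open>y\<close>, \<open>c\<close>.\<close>
    have main: "(\<exists>b c. subseq [b, c] ys \<and> x < c \<and> c < b) \<longleftrightarrow>
        \<not> length (filter (\<lambda>u. u < y) zs) \<le> length (filter (\<lambda>u. u < x) ys)"
      if av: "avoids ys [1,3,2]"
    proof
      assume "\<exists>b c. subseq [b, c] ys \<and> x < c \<and> c < b"
      then obtain b c where bc: "subseq [b, c] ys" "x < c" "c < b" by blast
      have "c \<in> set ys" using subseq_set[OF bc(1)] by auto
      have "c \<le> y"
      proof (rule ccontr)
        assume "\<not> c \<le> y"
        then have "subseq [y, b, c] ys" using bc by (auto simp: ys subseq_Cons2_iff split: if_splits)
        then show False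
          using \<open>\<not> c \<le> y\<close> bc(3) by (intro avoids_132_D[OF av, of y b c]) auto
      qed
      have "c \<noteq> y"
      proof
        assume "c = y"
        then have "subseq [b, c] zs" using bc by (auto simp: ys subseq_Cons2_iff split: if_splits)
        then have "y \<in> set zs" using subseq_set[of "[b, c]" zs] \<open>c = y\<close> by simp
        then show False using Cons.prems ys by simp
      qed
      then have "c < y" "c \<in> set zs" using \<open>c \<le> y\<close> \<open>c \<in> set ys\<close> ys by auto
      then have "length (filter (\<lambda>u. u < x) zs) < length (filter (\<lambda>u. u < y) zs)"
        using bc by (intro length_filter_strict_mono[of _ _ _ c]) auto
      then show "\<not> length (filter (\<lambda>u. u < y) zs) \<le> length (filter (\<lambda>u. u < x) ys)"
        using bc \<open>c < y\<close> by (auto simp: ys)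
    next
      assume *: "\<not> length (filter (\<lambda>u. u < y) zs) \<le> length (filter (\<lambda>u. u < x) ys)"
      have "\<exists>c \<in> set zs. c < y \<and> \<not> c < x"
      proof (rule ccontr)
        assume "\<not> (\<exists>c \<in> set zs. c < y \<and> \<not> c < x)"
        then have "length (filter (\<lambda>u. u < y) zs) \<le> length (filter (\<lambda>u. u < x) zs)"
          by (intro length_filter_mono) auto
        then show False using * by (auto simp: ys split: if_splits)
      qed
      then obtain c where c: "c \<in> set zs" "c < y" "\<not> c < x" by blast
      then have "c \<noteq> x" using Cons.prems ys by auto
      moreover have "subseq [y, c] ys" using c by (simp add: ys subseq_singleton_left)
      ultimately show "\<exists>b c. subseq [b, c] ys \<and> x < c \<and> c < b"
        using c by (metis linorder_less_linear)
    qed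
    show ?thesis
      unfolding split sorted using main IH by argo
  qed
qed


section \<open>Permutations avoiding 132 and partitions\<close>

definition nonzero_parts :: "nat list \<Rightarrow> nat multiset" where
  "nonzero_parts cs = filter_mset (\<lambda>c. c > 0) (mset cs)"

text \<open>Expressing the number of zeros through the length shows that lists of equal length with
  the same nonzero parts have the same multiset of entries.\<close>

lemma mset_eq_nonzero_parts:
  "mset cs = nonzero_parts cs + replicate_mset (length cs - size (nonzero_parts cs)) 0"
proof -
  have "mset cs = nonzero_parts cs + filter_mset (\<lambda>c. \<not> c > 0) (mset cs)"
    unfolding nonzero_parts_def by (rule multiset_partition)
  also have "filter_mset (\<lambda>c. \<not> c > 0) (mset cs) = replicate_mset (count (mset cs) 0) 0"
    by (simp flip: filter_eq_replicate_mset)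
  finally have eq: "mset cs = nonzero_parts cs + replicate_mset (count (mset cs) 0) 0" .
  from arg_cong[OF eq, of size] have "length cs - size (nonzero_parts cs) = count (mset cs) 0"
    by simp
  then show ?thesis
    by (rule ssubst) (rule eq)
qed

lemma sum_nonzero_parts: "sum_mset (nonzero_parts cs) = sum_list cs"
  using arg_cong[OF mset_eq_nonzero_parts[of cs], of sum_mset] by (simp add: sum_mset_sum_list)

text \<open>The length restores the zeros, and a multiset has only one sorted arrangement. The lists
  are reversed because \<open>sort\<close> is ascending.\<close>

lemma nonzero_parts_inj:
  assumes "sorted_wrt (\<ge>) cs" "sorted_wrt (\<ge>) ds" "length cs = length ds"
    and "nonzero_parts cs = nonzero_parts ds"
  shows "cs = ds"
proof -
  have "mset (rev cs) = mset (rev ds)"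
    using mset_eq_nonzero_parts[of cs] mset_eq_nonzero_parts[of ds] assms(3,4) by simp
  moreover have sorted: "sorted (rev cs)" "sorted (rev ds)"
    using assms(1,2) by (simp_all add: sorted_wrt_rev)
  ultimately have "sort (rev ds) = rev cs"
    by (intro properties_for_sort)
  with sorted(2) have "rev cs = rev ds"
    by (simp add: sorted_sort_id)
  then show ?thesis by simp
qed

text \<open>Each of the \<open>i\<close> earlier entries is at least \<open>cs ! i\<close>, hence at
  least 1, so together they add at least \<open>i\<close> to the sum.\<close>

lemma decreasing_nth_bound:
  fixes cs :: "nat list"
  assumes "sorted_wrt (\<ge>) cs" "i < length cs" "cs ! i > 0"
  shows "cs ! i + i \<le> sum_list cs"
proof -
  have ge: "cs ! i \<le> cs ! j" if "j \<le> i" for j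
    using assms(1,2) that by (cases "j = i") (auto simp: sorted_wrt_iff_nth_less)
  have "cs ! i + i \<le> cs ! i + (\<Sum>j<i. cs ! j)"
  proof -
    have "1 \<le> cs ! j" if "j \<in> {..<i}" for j
      using ge[of j] assms(3) that by simp
    from sum_bounded_below[of "{..<i}" 1, OF this] show ?thesis by simp
  qed
  also have "\<dots> = (\<Sum>j<Suc i. cs ! j)" by simp
  also have "\<dots> \<le> (\<Sum>j<length cs. cs ! j)"
    using assms(2) by (intro sum_mono2) auto
  also have "\<dots> = sum_list cs"
    by (simp add: sum_list_sum_nth atLeast0LessThan)
  finally show ?thesis .
qed

lemma size_le_sum_mset:
  "\<forall>x \<in># M. x > 0 \<Longrightarrow> size M \<le> sum_mset (M :: nat multiset)"
  by (induction M) auto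

text \<open>Deleting the zeros of the code is a bijection onto the partitions. The hypothesis
  \<open>k < n\<close> leaves room to pad a partition of \<open>k\<close> to length \<open>n\<close>
  and makes the result a valid code.\<close>

lemma card_avoids_132:
  assumes "k < n"
  shows "card {xs \<in> permutations_of_set {1..n}.
           card (inversions xs) = k \<and> avoids xs [1,3,2]} = num_partitions k"
    (is "card ?A = _")
proof -
  have A: "xs \<in> ?A \<longleftrightarrow> xs \<in> permutations_of_set {1..n} \<and>
      sum_list (lehmer xs) = k \<and> sorted_wrt (\<ge>) (lehmer xs)" for xs
    using avoids_132_iff_lehmer[OF permutations_of_setD(2), of xs "{1..n}"]
    by (auto simp: card_inversions simp del: One_nat_def)
  have "bij_betw (\<lambda>xs. nonzero_parts (lehmer xs)) ?A (integer_partitions k)"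
  proof (rule bij_betw_imageI)
    show "inj_on (\<lambda>xs. nonzero_parts (lehmer xs)) ?A"
    proof (rule inj_onI)
      fix xs ys
      assume "xs \<in> ?A" "ys \<in> ?A"
        and eq: "nonzero_parts (lehmer xs) = nonzero_parts (lehmer ys)"
      then have *: "xs \<in> permutations_of_set {1..n}" "ys \<in> permutations_of_set {1..n}"
        "sorted_wrt (\<ge>) (lehmer xs)" "sorted_wrt (\<ge>) (lehmer ys)"
        unfolding A by auto
      then have "length xs = length ys"
        by (simp add: length_finite_permutations_of_set)
      then have "lehmer xs = lehmer ys"
        using * eq by (intro nonzero_parts_inj) auto
      then show "xs = ys"
        using lehmer_inj[of xs ys] permutations_of_setD[OF *(1)] permutations_of_setD[OF *(2)]
        by simp
    qed
    show "(\<lambda>xs. nonzero_parts (lehmer xs)) ` ?A = integer_partitions k"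
    proof (intro equalityI subsetI)
      fix M assume "M \<in> (\<lambda>xs. nonzero_parts (lehmer xs)) ` ?A"
      then obtain xs where M: "M = nonzero_parts (lehmer xs)" and "xs \<in> ?A"
        by (rule imageE)
      then have "sum_mset M = k"
        unfolding A by (simp add: sum_nonzero_parts)
      moreover have "\<forall>x \<in># M. x > 0"
        by (simp add: M nonzero_parts_def)
      ultimately show "M \<in> integer_partitions k"
        by (simp add: integer_partitions_def)
    next
      fix M assume "M \<in> integer_partitions k"
      then have M: "\<forall>x \<in># M. x > 0" "sum_mset M = k"
        by (auto simp: integer_partitions_def)
      define N where "N = M + replicate_mset (n - size M) 0"
      define cs where "cs = rev (sorted_list_of_multiset N)"
      have mset: "mset cs = N" by (simp add: cs_def)
      have len: "length cs = n"
        using size_le_sum_mset[OF M(1)] M(2) assms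
        unfolding size_mset[symmetric] mset by (simp add: N_def)
      have sum: "sum_list cs = k"
        unfolding sum_mset_sum_list[symmetric] mset using M by (simp add: N_def)
      have sorted: "sorted_wrt (\<ge>) cs"
        by (simp add: cs_def sorted_wrt_rev)
      \<comment> \<open>A positive entry satisfies \<open>cs ! i + i \<le> k < n\<close>; for a zero
        entry the claim is just \<open>i < n\<close>.\<close>
      have "cs ! i + i < n" if "i < n" for i
        using decreasing_nth_bound[OF sorted, of i] that len sum assms by (cases "cs ! i = 0") auto
      then obtain xs where xs: "xs \<in> permutations_of_set {1..n}" "lehmer xs = cs"
        using lehmer_surj[of "{1..n}" cs] len by auto
      have "filter_mset (\<lambda>c. c > 0) M = M"
        using M(1) by (simp add: filter_mset_eq_conv)
      then have "nonzero_parts cs = M"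
        unfolding nonzero_parts_def mset N_def by simp
      moreover have "xs \<in> ?A" unfolding A using xs sum sorted by simp
      ultimately show "M \<in> (\<lambda>xs. nonzero_parts (lehmer xs)) ` ?A"
        using xs(2) by (intro image_eqI[of _ _ xs]) simp_all
    qed
  qed
  then show ?thesis
    unfolding num_partitions_def by (rule bij_betw_same_card)
qed


section \<open>Reverse complement\<close>

definition rev_compl :: "nat \<Rightarrow> nat list \<Rightarrow> nat list" where
  "rev_compl n xs = rev (map (\<lambda>x. n + 1 - x) xs)"

lemma rev_compl_perm:
  assumes "xs \<in> permutations_of_set {1..n}"
  shows "rev_compl n xs \<in> permutations_of_set {1..n}"
proof -
  have xs: "set xs = {1..n}" "distinct xs"
    using assms by (auto dest: permutations_of_setD)
  have "(\<lambda>x. n + 1 - x) ` {1..n} = {1..n}"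
  proof (intro equalityI subsetI)
    fix x assume "x \<in> {1..n}"
    then show "x \<in> (\<lambda>x. n + 1 - x) ` {1..n}"
      by (intro image_eqI[of _ _ "n + 1 - x"]) auto
  qed auto
  moreover have "inj_on (\<lambda>x. n + 1 - x) {1..n}"
    by (auto simp: inj_on_def)
  ultimately show ?thesis
    using xs by (intro permutations_of_setI) (auto simp: rev_compl_def distinct_map)
qed

lemma rev_compl_rev_compl:
  assumes "xs \<in> permutations_of_set {1..n}"
  shows "rev_compl n (rev_compl n xs) = xs"
proof -
  have "map (\<lambda>x. n + 1 - (n + 1 - x)) xs = xs"
    using permutations_of_setD(1)[OF assms] by (intro map_idI) auto
  then show ?thesis
    by (simp add: rev_compl_def rev_map comp_def)
qed

lemma rev_compl_nth:
  "i < length xs \<Longrightarrow> rev_compl n xs ! i = n + 1 - xs ! (length xs - Suc i)"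
  by (simp add: rev_compl_def rev_nth)

text \<open>Reversing positions and complementing values each turn inversions into non-inversions
  and back, so together they preserve them.\<close>

lemma card_inversions_rev_compl:
  assumes "xs \<in> permutations_of_set {1..n}"
  shows "card (inversions (rev_compl n xs)) = card (inversions xs)"
proof -
  have len: "length xs = n"
    using assms by (simp add: length_finite_permutations_of_set)
  have le: "xs ! i \<le> n" if "i < n" for i
    using permutations_of_setD(1)[OF assms] nth_mem[of i xs] that len by auto
  \<comment> \<open>Positions count from 0, so position \<open>i\<close> goes to
    \<open>n - Suc i\<close>; the pair is swapped to keep its positions increasing. This map is its
    own inverse.\<close>
  have "bij_betw (\<lambda>(i, j). (n - Suc j, n - Suc i)) (inversions (rev_compl n xs)) (inversions xs)"
    by (rule bij_betw_byWitness[where f' = "\<lambda>(i, j). (n - Suc j, n - Suc i)"])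
      (use le in \<open>auto simp: inversions_def rev_compl_nth len
         simp: rev_compl_def[of n xs, THEN arg_cong[where f = length]]
         intro!: diff_less_mono2 le_imp_less_Suc\<close>)
  then show ?thesis by (rule bij_betw_same_card)
qed

lemma subseq_rev:
  "subseq xs ys \<Longrightarrow> subseq (rev xs) (rev ys)"
  by (induction rule: list_emb.induct) (auto intro: list_emb_append_mono subseq_rev_drop_many)

lemma subseq_rev_compl:
  assumes "subseq ys xs"
  shows "subseq (rev_compl n ys) (rev_compl n xs)"
  unfolding rev_compl_def using assms by (simp add: subseq_map subseq_rev)

text \<open>The reverse complement of 213 is 132, so an occurrence in the image is pulled back by
  the involution.\<close>

lemma avoids_213_rev_compl:
  assumes "xs \<in> permutations_of_set {1..n}" "avoids xs [1,3,2]"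
  shows "avoids (rev_compl n xs) [2,1,3]"
  unfolding avoids_213_iff
proof (intro notI, elim exE conjE)
  fix a b c assume abc: "subseq [a, b, c] (rev_compl n xs)" "b < a" "a < c"
  \<comment> \<open>Subtraction is truncated; the bound on the largest entry keeps the complemented
    inequalities strict.\<close>
  have "c \<le> n"
    using subseq_set[OF abc(1)] rev_compl_perm[OF assms(1)] by (auto dest: permutations_of_setD)
  moreover have "subseq [n + 1 - c, n + 1 - b, n + 1 - a] xs"
    using subseq_rev_compl[OF abc(1), of n] rev_compl_rev_compl[OF assms(1)]
    by (simp add: rev_compl_def)
  moreover have "n + 1 - c < n + 1 - a" "n + 1 - a < n + 1 - b" using abc \<open>c \<le> n\<close> by auto
  ultimately show False
    by (intro avoids_132_D[OF assms(2)])
qed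

lemma avoids_132_rev_compl:
  assumes "xs \<in> permutations_of_set {1..n}" "avoids xs [2,1,3]"
  shows "avoids (rev_compl n xs) [1,3,2]"
  unfolding avoids_132_iff
proof (intro notI, elim exE conjE)
  fix a b c assume abc: "subseq [a, b, c] (rev_compl n xs)" "a < c" "c < b"
  have "b \<le> n"
    using subseq_set[OF abc(1)] rev_compl_perm[OF assms(1)] by (auto dest: permutations_of_setD)
  moreover have "subseq [n + 1 - c, n + 1 - b, n + 1 - a] xs"
    using subseq_rev_compl[OF abc(1), of n] rev_compl_rev_compl[OF assms(1)]
    by (simp add: rev_compl_def)
  moreover have "n + 1 - b < n + 1 - c" "n + 1 - c < n + 1 - a" using abc \<open>b \<le> n\<close> by auto
  ultimately show False
    by (intro avoids_213_D[OF assms(2)])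
qed

lemma card_avoids_213:
  "card {xs \<in> permutations_of_set {1..n}. card (inversions xs) = k \<and> avoids xs [2,1,3]} =
   card {xs \<in> permutations_of_set {1..n}. card (inversions xs) = k \<and> avoids xs [1,3,2]}"
  by (rule bij_betw_same_card[of "rev_compl n"],
      rule bij_betw_byWitness[where f' = "rev_compl n"])
    (auto simp: rev_compl_rev_compl rev_compl_perm card_inversions_rev_compl
       avoids_132_rev_compl avoids_213_rev_compl simp del: One_nat_def)


section \<open>Decomposability\<close>

text \<open>If no proper prefix is mapped to itself, every cut \<open>p\<close> lies in some interval
  \<open>{i..<\<pi>\<^sub>i}\<close>, and the \<open>i\<close>-th entry of the Lehmer code is at least the length of this interval.\<close>

lemma perm_decomposable:
  assumes "xs \<in> permutations_of_set {1..n}" "card (inversions xs) + 2 \<le> n"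
  obtains us vs where "xs = us @ vs" "us \<noteq> []" "vs \<noteq> []"
    "\<And>u v. u \<in> set us \<Longrightarrow> v \<in> set vs \<Longrightarrow> u < v"
proof -
  have xs: "set xs = {1..n}" "distinct xs" "length xs = n"
    using assms by (auto dest: permutations_of_setD simp: length_finite_permutations_of_set)
  \<comment> \<open>Of the \<open>xs ! i - 1\<close> smaller values at most \<open>i\<close> stand
    to the left; the others are counted by the code.\<close>
  have code: "xs ! i - Suc i \<le> lehmer xs ! i" if "i < n" for i
  proof -
    have "{1..<xs ! i} \<subseteq> set (take i xs) \<union> set (filter (\<lambda>y. y < xs ! i) (drop (Suc i) xs))"
    proof
      fix v assume v: "v \<in> {1..<xs ! i}"
      moreover have "xs ! i \<le> n" using xs(1) nth_mem[of i xs] xs(3) that by auto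
      ultimately have "v \<in> set xs" using xs(1) by auto
      also have "xs = take i xs @ xs ! i # drop (Suc i) xs"
        using that xs(3) by (simp add: id_take_nth_drop)
      finally show "v \<in> set (take i xs) \<union> set (filter (\<lambda>y. y < xs ! i) (drop (Suc i) xs))"
        using v by auto
    qed
    then have "card {1..<xs ! i} \<le>
        card (set (take i xs) \<union> set (filter (\<lambda>y. y < xs ! i) (drop (Suc i) xs)))"
      by (intro card_mono) auto
    also have "\<dots> \<le> length (take i xs) + length (filter (\<lambda>y. y < xs ! i) (drop (Suc i) xs))"
      by (intro order_trans[OF card_Un_le] add_mono card_length)
    finally show ?thesis
      using that xs(3) by (simp add: lehmer_nth)
  qed
  have "\<exists>p \<in> {1..<n}. \<forall>i<p. xs ! i \<le> p"
  proof (rule ccontr)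
    assume no: "\<not> (\<exists>p \<in> {1..<n}. \<forall>i<p. xs ! i \<le> p)"
    \<comment> \<open>With positions counted from 0, the interval of position \<open>i\<close> is
      \<open>{Suc i..<xs ! i}\<close>. Covering all \<open>n - 1\<close> cuts would need at least
      \<open>n - 1\<close> inversions, one more than the hypothesis allows.\<close>
    have "{1..<n} \<subseteq> (\<Union>i<n. {Suc i..<xs ! i})"
    proof
      fix p assume p: "p \<in> {1..<n}"
      then obtain i where "i < p" "\<not> xs ! i \<le> p" using no by blast
      then show "p \<in> (\<Union>i<n. {Suc i..<xs ! i})" using p by (intro UN_I[of i]) auto
    qed
    then have "card {1..<n} \<le> card (\<Union>i<n. {Suc i..<xs ! i})"
      by (intro card_mono) auto
    also have "\<dots> \<le> (\<Sum>i<n. card {Suc i..<xs ! i})"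
      by (intro card_UN_le) auto
    also have "\<dots> \<le> (\<Sum>i<n. lehmer xs ! i)"
      using code by (intro sum_mono) auto
    also have "\<dots> = card (inversions xs)"
      by (simp add: card_inversions sum_list_sum_nth atLeast0LessThan xs(3))
    finally show False using assms(2) by simp
  qed
  then obtain p where p: "1 \<le> p" "p < n" "\<forall>i<p. xs ! i \<le> p" by auto
  \<comment> \<open>The first \<open>p\<close> entries are distinct and lie in
    \<open>{1..p}\<close>, so they exhaust it, and all later entries exceed
    \<open>p\<close>.\<close>
  have sub: "set (take p xs) \<subseteq> {1..p}"
  proof
    fix u assume "u \<in> set (take p xs)"
    then show "u \<in> {1..p}"
      using p xs(1) by (auto simp: in_set_conv_nth dest: in_set_takeD) (metis nth_mem xs(3) order.strict_trans atLeastAtMost_iff)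
  qed
  moreover have "card (set (take p xs)) = p"
    using xs p by (simp add: distinct_card)
  ultimately have prefix: "set (take p xs) = {1..p}"
    by (intro card_subset_eq) auto
  have "set (take p xs) \<inter> set (drop p xs) = {}"
    using xs(2) by (simp add: set_take_disj_set_drop_if_distinct)
  moreover have "set (drop p xs) \<subseteq> {1..n}"
    using xs(1) set_drop_subset by fast
  ultimately have "u < v" if "u \<in> set (take p xs)" "v \<in> set (drop p xs)" for u v
    using that prefix by fastforce
  then show ?thesis
    using p xs(3) by (intro that[of "take p xs" "drop p xs"]) auto
qed

section \<open>Inversions in a direct sum\<close>

lemma inversion_subseq:
  assumes "inversions xs \<noteq> {}"
  obtains a b where "subseq [a, b] xs" "b < a"
proof -
  obtain i j where ij: "i < j" "j < length xs" "xs ! j < xs ! i"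
    using assms by (auto simp: inversions_def)
  have "xs ! i \<in> set (take j xs)"
    using ij by (auto simp: in_set_conv_nth intro!: exI[of _ i])
  then have "subseq [xs ! i] (take j xs)" by (simp add: subseq_singleton_left)
  moreover have "subseq [xs ! j] (drop j xs)"
    using ij by (simp add: subseq_singleton_left Cons_nth_drop_Suc[symmetric])
  ultimately have "subseq [xs ! i, xs ! j] xs"
    using list_emb_append_mono[of _ "[xs ! i]" "take j xs" "[xs ! j]" "drop j xs"] by simp
  then show ?thesis using ij(3) that by blast
qed

text \<open>A pair with its first entry in \<open>us\<close> and its second in \<open>vs\<close>
  would be increasing.\<close>

lemma inversion_in_block:
  assumes "subseq [a, b] (us @ vs)" "b < a"
    and "\<And>u v. u \<in> set us \<Longrightarrow> v \<in> set vs \<Longrightarrow> u < (v :: nat)"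
  shows "subseq [a, b] us \<or> subseq [a, b] vs"
proof -
  obtain ys zs where yz: "[a, b] = ys @ zs" "subseq ys us" "subseq zs vs"
    by (rule subseq_appendE[OF assms(1)])
  show ?thesis
  proof (cases "ys = [] \<or> zs = []")
    case True
    with yz show ?thesis by auto
  next
    case False
    then have "a \<in> set ys" "b \<in> set zs"
      using arg_cong[OF yz(1), of hd] arg_cong[OF yz(1), of last] hd_in_set[of ys] last_in_set[of zs]
      by simp_all
    then have "a < b"
      using subseq_set[OF yz(2)] subseq_set[OF yz(3)] by (intro assms(3)) auto
    with assms(2) show ?thesis by simp
  qed
qed

section \<open>Splitting the count into 132-avoiders and 213-avoiders\<close>

theorem proposition5p6:
  fixes n k :: nat
  assumes "k \<ge> 1" and "n \<ge> k + 2"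
  shows "av n k {[1,3,2,4], [2,1,4,3]} = 2 * num_partitions k"
proof -
  let ?S = "\<lambda>P. {xs \<in> permutations_of_set {1..n}. card (inversions xs) = k \<and> P xs}"
  let ?A = "?S (\<lambda>xs. avoids xs [1,3,2])"
  let ?B = "?S (\<lambda>xs. avoids xs [2,1,3])"
  have "avoids xs [1,3,2] \<or> avoids xs [2,1,3]"
    if xs: "xs \<in> permutations_of_set {1..n}" "card (inversions xs) = k"
      and av: "avoids xs [1,3,2,4]" "avoids xs [2,1,4,3]" for xs
  proof (rule ccontr)
    assume "\<not> (avoids xs [1,3,2] \<or> avoids xs [2,1,3])"
    then obtain a b c d e f where abc: "subseq [a, b, c] xs" "a < c" "c < b"
      and def: "subseq [d, e, f] xs" "e < d" "d < f"
      unfolding avoids_132_iff avoids_213_iff by auto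
    obtain us vs where uv: "xs = us @ vs" "us \<noteq> []" "vs \<noteq> []"
      and less: "\<And>u v. u \<in> set us \<Longrightarrow> v \<in> set vs \<Longrightarrow> u < v"
      using perm_decomposable[OF xs(1)] xs(2) assms(2) by auto
    \<comment> \<open>If \<open>c\<close> lies in \<open>us\<close>, no letter of the 132 can come
      from \<open>vs\<close>, so the whole occurrence is in \<open>us\<close>, and
      \<open>hd vs\<close> serves as the 4 of a 1324.\<close>
    have not_us: "\<not> subseq [b, c] us"
    proof
      assume "subseq [b, c] us"
      then have "c \<in> set us" by (auto dest: subseq_set)
      obtain ys zs where yz: "[a, b, c] = ys @ zs" "subseq ys us" "subseq zs vs"
        by (rule subseq_appendE[OF abc(1)[unfolded uv(1)]])
      have "zs = []"
      proof (rule ccontr)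
        assume "zs \<noteq> []"
        then have "c \<in> set zs"
          using arg_cong[OF yz(1), of last] last_in_set[of zs] by simp
        then show False
          using less[OF \<open>c \<in> set us\<close>, of c] subseq_set[OF yz(3)] by auto
      qed
      then have "subseq [a, b, c] us" using yz by simp
      moreover have "subseq [hd vs] vs" using uv(3) by (simp add: subseq_singleton_left)
      ultimately have "subseq [a, b, c, hd vs] xs"
        using list_emb_append_mono[of _ "[a, b, c]" us "[hd vs]" vs] uv(1) by simp
      moreover have "b < hd vs"
        using subseq_set[OF \<open>subseq [b, c] us\<close>] less uv(3) by simp
      ultimately show False
        using avoids_1324_D[OF av(1), of a b c "hd vs"] abc(2,3) by simp
    qed
    \<comment> \<open>Symmetrically, the whole 213 would lie in \<open>vs\<close>, and
      \<open>hd us\<close> would serve as the 1 of a 1324.\<close>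
    have not_vs: "\<not> subseq [d, e] vs"
    proof
      assume "subseq [d, e] vs"
      then have "d \<in> set vs" by (auto dest: subseq_set)
      obtain ys zs where yz: "[d, e, f] = ys @ zs" "subseq ys us" "subseq zs vs"
        by (rule subseq_appendE[OF def(1)[unfolded uv(1)]])
      have "ys = []"
      proof (rule ccontr)
        assume "ys \<noteq> []"
        then have "d \<in> set ys" using yz(1) by (auto simp: Cons_eq_append_conv)
        then show False
          using less[OF _ \<open>d \<in> set vs\<close>, of d] subseq_set[OF yz(2)] by auto
      qed
      then have "subseq [d, e, f] vs" using yz by simp
      moreover have "subseq [hd us] us" using uv(2) by (simp add: subseq_singleton_left)
      ultimately have "subseq [hd us, d, e, f] xs"
        using list_emb_append_mono[of _ "[hd us]" us "[d, e, f]" vs] uv(1) by simp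
      moreover have "hd us < e"
        using subseq_set[OF \<open>subseq [d, e] vs\<close>] less uv(2) by simp
      ultimately show False
        using avoids_1324_D[OF av(1), of "hd us" d e f] def(2,3) by simp
    qed
    have "subseq [b, c] xs" using abc(1) by (rule subseq_Cons')
    then have bc: "subseq [b, c] vs"
      using inversion_in_block[OF _ abc(3) less, of us vs] not_us unfolding uv(1) by simp
    have "subseq [d, e] xs"
      by (rule subseq_order.trans[OF _ def(1)]) simp
    then have de: "subseq [d, e] us"
      using inversion_in_block[OF _ def(2) less, of us vs] not_vs unfolding uv(1) by simp
    \<comment> \<open>The descent of the 213 lies in the lower block and that of the 132 in the
      upper one; together they form a 2143.\<close>
    have "subseq [d, e, b, c] xs"
      using list_emb_append_mono[OF de bc] uv by simp
    moreover have "d < c"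
      using less subseq_set[OF bc] subseq_set[OF de] by auto
    ultimately show False
      using avoids_2143_D[OF av(2), of d e b c] abc(3) def(2) by simp
  qed
  then have "{xs \<in> permutations_of_set {1..n}. card (inversions xs) = k \<and>
      (\<forall>q \<in> {[1,3,2,4], [2,1,4,3]}. avoids xs q)} = ?A \<union> ?B"
    using avoids_132_imp avoids_213_imp by (auto simp del: One_nat_def)
  then have "av n k {[1,3,2,4], [2,1,4,3]} = card (?A \<union> ?B)"
    unfolding av_def by (rule arg_cong)
  moreover have "?A \<inter> ?B = {}"
  proof -
    \<comment> \<open>Since \<open>k \<ge> 1\<close> there is an inversion. In \<open>us\<close> it
      forms a 213 with any entry of \<open>vs\<close>; in \<open>vs\<close> it forms a 132 with any
      entry of \<open>us\<close>.\<close>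
    have False if xs: "xs \<in> permutations_of_set {1..n}" "card (inversions xs) = k"
      and av: "avoids xs [1,3,2]" "avoids xs [2,1,3]" for xs
    proof -
      obtain us vs where uv: "xs = us @ vs" "us \<noteq> []" "vs \<noteq> []"
        and less: "\<And>u v. u \<in> set us \<Longrightarrow> v \<in> set vs \<Longrightarrow> u < v"
        using perm_decomposable[OF xs(1)] xs(2) assms(2) by auto
      have "inversions xs \<noteq> {}" using xs(2) assms(1) by auto
      then obtain a b where ab: "subseq [a, b] xs" "b < a"
        using inversion_subseq by blast
      have "subseq [a, b] us \<or> subseq [a, b] vs"
        using inversion_in_block[OF _ ab(2) less, of us vs] ab(1) unfolding uv(1) by simp
      then show ?thesis
      proof (elim disjE)
        assume 1: "subseq [a, b] us"
        moreover have "subseq [hd vs] vs" using uv(3) by (simp add: subseq_singleton_left)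
        ultimately have "subseq [a, b, hd vs] xs"
          using list_emb_append_mono[of _ "[a, b]" us "[hd vs]" vs] uv(1) by simp
        moreover have "a < hd vs" using subseq_set[OF 1] less uv(3) by simp
        ultimately show ?thesis
          using avoids_213_D[OF av(2), of a b "hd vs"] ab(2) by simp
      next
        assume 2: "subseq [a, b] vs"
        moreover have "subseq [hd us] us" using uv(2) by (simp add: subseq_singleton_left)
        ultimately have "subseq [hd us, a, b] xs"
          using list_emb_append_mono[of _ "[hd us]" us "[a, b]" vs] uv(1) by simp
        moreover have "hd us < b" using subseq_set[OF 2] less uv(2) by simp
        ultimately show ?thesis
          using avoids_132_D[OF av(1), of "hd us" a b] ab(2) by simp
      qed
    qed
    then show ?thesis by auto
  qed
  from card_Un_disjoint[OF _ _ this] have "card (?A \<union> ?B) = card ?A + card ?B"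
    by simp
  moreover have "card ?A = num_partitions k"
    using assms(2) by (intro card_avoids_132) simp
  moreover have "card ?B = card ?A"
    by (rule card_avoids_213)
  ultimately show ?thesis by simp
qed

end
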